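(* Let $\mathcal{M}=(W,\sim,V)$ be a proper $\delta$-model and let $\mathcal{C}=(\mathbb{C},L)$ be a $\delta$-translation of $\mathcal{M}$ via a mapping $T:W\to\mathbb{C}$. Then for every $w\in W$ and every formula $\varphi$: $\mathcal{M},w\Vdash\varphi$ if and only if $\mathcal{C},T(w)\Vdash_\sigma\varphi$.
   Context: Fix a finite set $\mathsf{Ag}$ of agents; an agent pattern is a set $G\subseteq\mathcal{P}(\mathsf{Ag})\setminus\{\emptyset\}$. Formulas: $\varphi::= p\mid\neg\varphi\mid\varphi\wedge\varphi\mid [G]\varphi$ ($p$ in a countable set $\mathsf{Prop}$, $G$ an agent pattern). Let $\mathsf{Ag}_{si}=\{(A,i)\mid A\subseteq\mathsf{Ag},\ i\in\mathbb{N}\}$; $(A,i)\in S$ is maximal in $S$ if $|A|\ge|B|$ for all $(B,j)\in S$. A nonempty $S\subseteq\mathsf{Ag}_{si}$ is a simplex if (S1) it has a unique maximal element $\max(S)$; (S2) for every $(B,i)\in S$ and $C\subseteq B$ there is exactly one $j$ with $(C,j)\in S$; (S3) if $(B,i)\in S$ and $(A,j)=\max(S)$ then $B\subseteq A$. A set $\mathbb{C}$ of simplices is a complex if for all $S,T\in\mathbb{C}$: if $(A,i)\in S\cap T$ then for all $B\subseteq A$ and $j$, $(B,j)\in S$ iff $(B,j)\in T$. $S^\circ=\{A\mid\exists i\,(A,i)\in S\}$; $S\sim_G T$ iff $G\subseteq(S\cap T)^\circ$. A simplicial model is $(\mathbb{C},L)$ with $\mathbb{C}$ a complex and $L:\mathbb{C}\to\mathcal{P}(\mathsf{Prop})$;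 $\mathcal{C},S\Vdash_\sigma p$ iff $p\in L(S)$; Boolean clauses as usual; $\mathcal{C},S\Vdash_\sigma[G]\varphi$ iff $\mathcal{C},T'\Vdash_\sigma\varphi$ for all $T'\in\mathbb{C}$ with $S\sim_G T'$. A pre-model $\mathcal{M}=(W,\sim,V)$: $W$ a set, $\sim_G$ a symmetric transitive relation on $W$ for each agent pattern $G$, $V:W\to\mathcal{P}(\mathsf{Prop})$; $\mathcal{M},w\Vdash p$ iff $p\in V(w)$; Boolean clauses as usual; $\mathcal{M},w\Vdash[G]\varphi$ iff $\mathcal{M},v\Vdash\varphi$ for all $v$ with $w\sim_G v$. $\mathsf{alive}(G)_\mathcal{M}=\{w\mid w\sim_G w\}$. A $\delta$-model is a pre-model with, for all agent patterns $G,H$: (K2) $\mathsf{alive}(G)_\mathcal{M}\subseteq\mathsf{alive}(\{A\cup B\})_\mathcal{M}$ for $A,B\in G$; (K3) $\sim_H\subseteq\sim_G$ if $G\subseteq H$; (K4) $\sim_G\subseteq\sim_{G\cup\{B\}}$ if some $A\in G$ has $\emptyset\ne B\subseteq A$; (NE) every $w$ has some $G$ with $w\sim_G w$; (D) $\sim_G=\bigcap_{B\in G}\sim_{\{B\}}$. For $w\in W$ let $\overline{w}=\{B\mid\exists G.\ B\in G\text{ and }w\in\mathsf{alive}(G)_\mathcal{M}\}$; $w\equiv v$ iff $\overline{w}=\overline{v}$ and $w\sim_{\overline{w}}v$; $\mathcal{M}$ is proper iff $w\equiv v$ implies $w=v$. $\mathcal{C}=(\mathbb{C},L)$ is a $\delta$-translation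 of $\mathcal{M}$ via $T:W\to\mathbb{C}$ if for all $w,v\in W$, all agent patterns $G$ and all $p$: (1) $G\subseteq(T(w)\cap T(v))^\circ$ iff $w\sim_G v$; (2) $p\in L(T(w))$ iff $p\in V(w)$.
   Formalization: The mapping T is additionally assumed to be onto the complex (every simplex is T(v) for some world v); without this the claim fails, since [G] on the simplicial side ranges over simplices outside the image of T, where atoms may be labelled arbitrarily. *)

theory Defs
  imports Main "HOL-Library.Countable" "HOL-Library.FuncSet"
begin

definition agent_pattern :: "'a set \<Rightarrow> 'a set set \<Rightarrow> bool" where
  "agent_pattern Ag G \<longleftrightarrow> G \<subseteq> Pow Ag - {{}}"

datatype ('a, 'p) formula =
    Atom 'p
  | Neg "('a, 'p) formula"
  | Conj "('a, 'p) formula" "('a, 'p) formula"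
  | Box "'a set set" "('a, 'p) formula"

text \<open>The datatype admits arbitrary families of sets as modalities; the formulas of the
  language over \<open>Ag\<close> are those in which only agent patterns occur.\<close>

primrec formula_over :: "'a set \<Rightarrow> ('a, 'p) formula \<Rightarrow> bool" where
  "formula_over Ag (Atom p) \<longleftrightarrow> True"
| "formula_over Ag (Neg \<phi>) \<longleftrightarrow> formula_over Ag \<phi>"
| "formula_over Ag (Conj \<phi> \<psi>) \<longleftrightarrow> formula_over Ag \<phi> \<and> formula_over Ag \<psi>"
| "formula_over Ag (Box G \<phi>) \<longleftrightarrow> agent_pattern Ag G \<and> formula_over Ag \<phi>"

definition Ag_si :: "'a set \<Rightarrow> ('a set \<times> nat) set" where
  "Ag_si Ag = Pow Ag \<times> UNIV"

definition maximal_in :: "('a set \<times> nat) set \<Rightarrow> 'a set \<times> nat \<Rightarrow> bool" where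
  "maximal_in S x \<longleftrightarrow> x \<in> S \<and> (\<forall>y\<in>S. card (fst y) \<le> card (fst x))"

definition simplex_max :: "('a set \<times> nat) set \<Rightarrow> 'a set \<times> nat" where
  "simplex_max S = (THE x. maximal_in S x)"

definition simplex :: "'a set \<Rightarrow> ('a set \<times> nat) set \<Rightarrow> bool" where
  "simplex Ag S \<longleftrightarrow>
     S \<noteq> {} \<and> S \<subseteq> Ag_si Ag \<and>
     (\<exists>!x. maximal_in S x) \<and>
     (\<forall>B i C. (B, i) \<in> S \<and> C \<subseteq> B \<longrightarrow> (\<exists>!j. (C, j) \<in> S)) \<and>
     (\<forall>B i A j. (B, i) \<in> S \<and> (A, j) = simplex_max S \<longrightarrow> B \<subseteq> A)"

definition complex :: "'a set \<Rightarrow> ('a set \<times> nat) set set \<Rightarrow> bool" where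
  "complex Ag K \<longleftrightarrow>
     (\<forall>S\<in>K. simplex Ag S) \<and>
     (\<forall>S\<in>K. \<forall>T\<in>K. \<forall>A i. (A, i) \<in> S \<inter> T \<longrightarrow>
        (\<forall>B\<subseteq>A. \<forall>j. (B, j) \<in> S \<longleftrightarrow> (B, j) \<in> T))"

definition shadow :: "('a set \<times> nat) set \<Rightarrow> 'a set set" where
  "shadow S = {A. \<exists>i. (A, i) \<in> S}"

definition simplex_sim ::
    "'a set set \<Rightarrow> ('a set \<times> nat) set \<Rightarrow> ('a set \<times> nat) set \<Rightarrow> bool" where
  "simplex_sim G S T \<longleftrightarrow> G \<subseteq> shadow (S \<inter> T)"

record ('a, 'p) simplicial =
  simplices :: "('a set \<times> nat) set set"
  label :: "('a set \<times> nat) set \<Rightarrow> 'p set"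

definition simplicial_model :: "'a set \<Rightarrow> ('a, 'p) simplicial \<Rightarrow> bool" where
  "simplicial_model Ag C \<longleftrightarrow> complex Ag (simplices C)"

primrec simplicial_sat ::
    "('a, 'p) simplicial \<Rightarrow> ('a set \<times> nat) set \<Rightarrow> ('a, 'p) formula \<Rightarrow> bool" where
  "simplicial_sat C S (Atom p) \<longleftrightarrow> p \<in> label C S"
| "simplicial_sat C S (Neg \<phi>) \<longleftrightarrow> \<not> simplicial_sat C S \<phi>"
| "simplicial_sat C S (Conj \<phi> \<psi>) \<longleftrightarrow> simplicial_sat C S \<phi> \<and> simplicial_sat C S \<psi>"
| "simplicial_sat C S (Box G \<phi>) \<longleftrightarrow>
     (\<forall>T\<in>simplices C. simplex_sim G S T \<longrightarrow> simplicial_sat C T \<phi>)"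

record ('w, 'a, 'p) kripke =
  worlds :: "'w set"
  rel :: "'a set set \<Rightarrow> 'w rel"
  val :: "'w \<Rightarrow> 'p set"

definition pre_model :: "'a set \<Rightarrow> ('w, 'a, 'p) kripke \<Rightarrow> bool" where
  "pre_model Ag M \<longleftrightarrow>
     (\<forall>G. agent_pattern Ag G \<longrightarrow>
        rel M G \<subseteq> worlds M \<times> worlds M \<and> sym (rel M G) \<and> trans (rel M G))"

primrec kripke_sat ::
    "('w, 'a, 'p) kripke \<Rightarrow> 'w \<Rightarrow> ('a, 'p) formula \<Rightarrow> bool" where
  "kripke_sat M w (Atom p) \<longleftrightarrow> p \<in> val M w"
| "kripke_sat M w (Neg \<phi>) \<longleftrightarrow> \<not> kripke_sat M w \<phi>"
| "kripke_sat M w (Conj \<phi> \<psi>) \<longleftrightarrow> kripke_sat M w \<phi> \<and> kripke_sat M w \<psi>"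
| "kripke_sat M w (Box G \<phi>) \<longleftrightarrow>
     (\<forall>v\<in>worlds M. (w, v) \<in> rel M G \<longrightarrow> kripke_sat M v \<phi>)"

definition alive :: "('w, 'a, 'p) kripke \<Rightarrow> 'a set set \<Rightarrow> 'w set" where
  "alive M G = {w \<in> worlds M. (w, w) \<in> rel M G}"

text \<open>The conjuncts are (K2), (K3), (K4), (NE) and (D). The intersection in (D) is taken among
  relations on the set of worlds, so the empty pattern yields the full relation.\<close>

definition delta_model :: "'a set \<Rightarrow> ('w, 'a, 'p) kripke \<Rightarrow> bool" where
  "delta_model Ag M \<longleftrightarrow>
     pre_model Ag M \<and>
     (\<forall>G A B. agent_pattern Ag G \<and> A \<in> G \<and> B \<in> G \<longrightarrow> alive M G \<subseteq> alive M {A \<union> B}) \<and>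
     (\<forall>G H. agent_pattern Ag G \<and> agent_pattern Ag H \<and> G \<subseteq> H \<longrightarrow> rel M H \<subseteq> rel M G) \<and>
     (\<forall>G A B. agent_pattern Ag G \<and> A \<in> G \<and> B \<noteq> {} \<and> B \<subseteq> A \<longrightarrow>
        rel M G \<subseteq> rel M (G \<union> {B})) \<and>
     (\<forall>w\<in>worlds M. \<exists>G. agent_pattern Ag G \<and> (w, w) \<in> rel M G) \<and>
     (\<forall>G. agent_pattern Ag G \<longrightarrow>
        rel M G = (worlds M \<times> worlds M) \<inter> (\<Inter>B\<in>G. rel M {B}))"

definition alive_groups :: "'a set \<Rightarrow> ('w, 'a, 'p) kripke \<Rightarrow> 'w \<Rightarrow> 'a set set" where
  "alive_groups Ag M w = {B. \<exists>G. agent_pattern Ag G \<and> B \<in> G \<and> w \<in> alive M G}"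

definition world_equiv :: "'a set \<Rightarrow> ('w, 'a, 'p) kripke \<Rightarrow> 'w \<Rightarrow> 'w \<Rightarrow> bool" where
  "world_equiv Ag M w v \<longleftrightarrow>
     alive_groups Ag M w = alive_groups Ag M v \<and> (w, v) \<in> rel M (alive_groups Ag M w)"

definition proper :: "'a set \<Rightarrow> ('w, 'a, 'p) kripke \<Rightarrow> bool" where
  "proper Ag M \<longleftrightarrow>
     (\<forall>w\<in>worlds M. \<forall>v\<in>worlds M. world_equiv Ag M w v \<longrightarrow> w = v)"

definition delta_translation ::
    "'a set \<Rightarrow> ('w, 'a, 'p) kripke \<Rightarrow> ('a, 'p) simplicial \<Rightarrow> ('w \<Rightarrow> ('a set \<times> nat) set) \<Rightarrow> bool" where
  "delta_translation Ag M C T \<longleftrightarrow>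
     T \<in> worlds M \<rightarrow> simplices C \<and>
     (\<forall>w\<in>worlds M. \<forall>v\<in>worlds M. \<forall>G. agent_pattern Ag G \<longrightarrow>
        (G \<subseteq> shadow (T w \<inter> T v) \<longleftrightarrow> (w, v) \<in> rel M G)) \<and>
     (\<forall>w\<in>worlds M. \<forall>p. p \<in> label C (T w) \<longleftrightarrow> p \<in> val M w)"

end

theory Submission
  imports Defs
begin

text \<open>Induction on \<phi>: \<open>T\<close> acts as a functional bisimulation onto
  \<open>simplices C\<close>, preserving labels and, for agent patterns, both preserving and
  reflecting accessibility. Surjectivity, a hypothesis separate from
  \<open>delta_translation\<close>, carries the box case: a simplex outside the image could refute a
  boxed formula true at \<open>w\<close>.\<close>

theorem theorem5p60:
  fixes Ag :: "'a set"
    and M :: "('w, 'a, 'p::countable) kripke"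
    and C :: "('a, 'p) simplicial"
    and T :: "'w \<Rightarrow> ('a set \<times> nat) set"
    and w :: 'w
    and \<phi> :: "('a, 'p) formula"
  assumes "finite Ag"
    and "delta_model Ag M"
    and "proper Ag M"
    and "simplicial_model Ag C"
    and "delta_translation Ag M C T"
    and "T ` worlds M = simplices C"
    and "w \<in> worlds M"
    and "formula_over Ag \<phi>"
  shows "kripke_sat M w \<phi> \<longleftrightarrow> simplicial_sat C (T w) \<phi>"
  using assms(7,8)
proof (induction \<phi> arbitrary: w)
  case (Atom p)
  then show ?case
    using assms(5) by (simp add: delta_translation_def)
next
  case (Box G \<phi>)
  then have G: "agent_pattern Ag G" and \<phi>: "formula_over Ag \<phi>"
    by simp_all
  \<comment> \<open>Surjectivity: every simplex is some \<open>T v\<close>, so the box at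
    \<open>T w\<close> ranges over worlds.\<close>
  have "simplicial_sat C (T w) (Box G \<phi>) \<longleftrightarrow>
      (\<forall>v\<in>worlds M. simplex_sim G (T w) (T v) \<longrightarrow> simplicial_sat C (T v) \<phi>)"
    by (simp flip: assms(6))
  \<comment> \<open>The two relations agree because \<open>G\<close> is an agent pattern; the
    induction hypothesis holds at every world \<open>v\<close>.\<close>
  also have "\<dots> \<longleftrightarrow> (\<forall>v\<in>worlds M. (w, v) \<in> rel M G \<longrightarrow> kripke_sat M v \<phi>)"
    using assms(5) G \<phi> Box.prems(1) Box.IH
    by (simp add: delta_translation_def simplex_sim_def)
  finally show ?case
    by simp
qed simp_all

end
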